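(* Let $r\in\mathbb{N}$. For every real $x>0$, $$R_r(x)=C_r\,x^{\frac{2}{r+1}}+O_r\!\left(x^{\frac{2(r-1)}{r^2}}\right),$$ where the implied constant depends only on $r$.
   Context: $\mathbb{N}=\{1,2,3,\dots\}$. For $\mathbf{y}=(y_1,\dots,y_r)$ define $$a_r(\mathbf{y}):=\frac{1}{c_r}\prod_{1\le \ell\le j\le r}(y_\ell+y_{\ell+1}+\dots+y_j),\qquad c_r:=r!\,(r-1)!\cdots 1!.$$ For $\mathbf{k}\in\mathbb{N}^r$, $a_r(\mathbf{k})$ is the dimension of the irreducible representation of $\mathfrak{sl}_{r+1}(\mathbb{C})$ with highest weight $(k_1-1)\boldsymbol{\lambda}_1+\dots+(k_r-1)\boldsymbol{\lambda}_r$ ($\boldsymbol{\lambda}_j$ the fundamental weights). Define $$\varrho_r(m):=\#\{\mathbf{k}\in\mathbb{N}^r: a_r(\mathbf{k})=m\},\qquad R_r(x):=\sum_{m\le x}\varrho_r(m)$$ (sum over positive integers $m\le x$), and $$C_r:=\int_{\mathbf{y}\in\mathbb{R}_{>0}^r,\ a_r(\mathbf{y})\le 1} dy_1\cdots dy_r .$$ *)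

theory Defs
  imports "HOL-Analysis.Analysis"
begin

text \<open>Vectors \<open>(y\<^sub>1, \<dots>, y\<^sub>r)\<close> are functions on the index set \<open>{1..r}\<close>.\<close>

definition dim_const :: "nat \<Rightarrow> real" where
  "dim_const r = (\<Prod>i=1..r. fact i)"

definition dim_poly :: "nat \<Rightarrow> (nat \<Rightarrow> real) \<Rightarrow> real" where
  "dim_poly r y = 1 / dim_const r * (\<Prod>j=1..r. \<Prod>l=1..j. \<Sum>i=l..j. y i)"

text \<open>Extensional functions (\<open>undefined\<close> off \<open>{1..r}\<close>) represent each tuple in
  \<open>{1, 2, \<dots>}\<^sup>r\<close> exactly once, so that cardinalities count tuples.\<close>

definition highest_weights :: "nat \<Rightarrow> nat \<Rightarrow> (nat \<Rightarrow> nat) set" where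
  "highest_weights r m = {k \<in> {1..r} \<rightarrow>\<^sub>E {1..}. dim_poly r (\<lambda>i. real (k i)) = real m}"

definition num_irreps :: "nat \<Rightarrow> nat \<Rightarrow> nat" where
  "num_irreps r m = card (highest_weights r m)"

definition num_irreps_upto :: "nat \<Rightarrow> real \<Rightarrow> nat" where
  "num_irreps_upto r x = (\<Sum>m\<in>{m. 1 \<le> m \<and> real m \<le> x}. num_irreps r m)"

definition dim_region :: "nat \<Rightarrow> (nat \<Rightarrow> real) set" where
  "dim_region r = {y \<in> {1..r} \<rightarrow>\<^sub>E {0<..}. dim_poly r y \<le> 1}"

definition leading_const :: "nat \<Rightarrow> real" where
  "leading_const r = (LINT y:dim_region r|(\<Pi>\<^sub>M j\<in>{1..r}. lborel). 1)"

text \<open>Neither the cardinality nor the sum above takes its default value 0 for infinite sets.\<close>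

lemma dim_const_pos: "dim_const r > 0"
  unfolding dim_const_def by (intro prod_pos) auto

lemma finite_highest_weights: "finite (highest_weights r m)"
proof (rule finite_subset)
  show "finite ({1..r} \<rightarrow>\<^sub>E {1..nat \<lceil>dim_const r * real m\<rceil>})"
    by (intro finite_PiE) auto
  show "highest_weights r m \<subseteq> {1..r} \<rightarrow>\<^sub>E {1..nat \<lceil>dim_const r * real m\<rceil>}"
  proof
    fix k assume k: "k \<in> highest_weights r m"
    then have kE: "k \<in> {1..r} \<rightarrow>\<^sub>E {1..}"
      and dim: "dim_poly r (\<lambda>i. real (k i)) = real m"
      by (auto simp: highest_weights_def)
    have k1: "1 \<le> real (k i)" if "i \<in> {1..r}" for i
      using PiE_mem[OF kE that] by simp
    have sum1: "1 \<le> (\<Sum>i=l..j. real (k i))" if "j \<in> {1..r}" "l \<in> {1..j}" for l j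
    proof -
      have "real (k j) \<le> (\<Sum>i=l..j. real (k i))"
        using that by (intro member_le_sum) auto
      with k1[OF that(1)] show ?thesis by linarith
    qed
    have inner1: "1 \<le> (\<Prod>l=1..j. \<Sum>i=l..j. real (k i))" if "j \<in> {1..r}" for j
      using sum1[OF that] by (intro prod_ge_1) auto
    have "real (k j) \<le> dim_const r * real m" if j: "j \<in> {1..r}" for j
    proof -
      have split_inner: "(\<Prod>l=1..j. \<Sum>i=l..j. real (k i)) =
          real (k j) * (\<Prod>l\<in>{1..j} - {j}. \<Sum>i=l..j. real (k i))"
        using j by (subst prod.remove[of _ j]) auto
      have "1 \<le> (\<Prod>l\<in>{1..j} - {j}. \<Sum>i=l..j. real (k i))"
        using sum1[OF j] by (intro prod_ge_1) auto
      then have "real (k j) \<le> (\<Prod>l=1..j. \<Sum>i=l..j. real (k i))"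
        unfolding split_inner by (simp add: mult_le_cancel_left1)
      also have "\<dots> \<le> (\<Prod>j=1..r. \<Prod>l=1..j. \<Sum>i=l..j. real (k i))"
      proof -
        have "1 \<le> (\<Prod>j\<in>{1..r} - {j}. \<Prod>l=1..j. \<Sum>i=l..j. real (k i))"
          by (rule prod_ge_1) (rule inner1, simp)
        then show ?thesis
          using inner1[OF j] j by (subst prod.remove[of "{1..r}" j]) (auto simp: mult_le_cancel_left1)
      qed
      also have "\<dots> = dim_const r * real m"
        using dim dim_const_pos[of r] by (simp add: dim_poly_def field_simps)
      finally show ?thesis .
    qed
    then have "k j \<le> nat \<lceil>dim_const r * real m\<rceil>" if "j \<in> {1..r}" for j
      using that real_nat_ceiling_ge order_trans of_nat_le_iff by blast
    then show "k \<in> {1..r} \<rightarrow>\<^sub>E {1..nat \<lceil>dim_const r * real m\<rceil>}"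
      using kE by (auto simp: PiE_iff)
  qed
qed

lemma finite_dimensions_upto: "finite {m. 1 \<le> m \<and> real m \<le> x}"
  by (rule finite_subset[of _ "{..nat \<lfloor>x\<rfloor>}"]) (auto simp: le_nat_floor)

end

theory Submission
  imports Defs "Jordan_Normal_Form.Determinant"
begin

text \<open>Since the dimension polynomial takes integer values at integer points, \<open>num_irreps_upto r x\<close>
  is the number of lattice points with positive coordinates in
  \<open>D x = {y > 0. dim_poly r y \<le> x}\<close>. The integrality
  (\<open>dim_poly_in_Nats\<close>) holds because the numerator is a Vandermonde product in the partial sums
  of the \<open>k i\<close>, and such a product of differences of integers is divisible by a product of
  factorials.

  As the polynomial is monotone, \<open>D x\<close> is closed under decreasing coordinates. Attaching
  unit cubes to the lattice points, once at their upper and once at their lower corners, shows that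
  their number differs from the volume of \<open>D x\<close> by at most the volume of the \<open>r\<close>
  boundary layers \<open>{y \<in> D x. y i \<le> 1}\<close> (\<open>num_irreps_upto_le_volume\<close>,
  \<open>volume_le_num_irreps_upto\<close>). By homogeneity the volume of \<open>D x\<close> is exactly the main
  term (\<open>measure_dim_sublevel\<close>).

  It remains to see that \<open>D x\<close> has finite volume, although it is unbounded for
  \<open>r \<ge> 2\<close>, and to bound the layers. Both follow from the inequality
  \<open>y l + \<dots> + y j \<ge> max (y l) (y j)\<close>, which reduces the question to the form
  \<open>(\<Prod>i. y i ^ q) * (\<Prod>l<j. max (y l) (y j))\<close> with \<open>q = 1\<close>. Splitting off a
  coordinate of value \<open>t\<close> bounds this form from below by \<open>t ^ q\<close> times the same form
  with \<open>q + 1\<close> in the other coordinates, so volumes can be bounded by induction on the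
  number of coordinates, using a one-dimensional integral of a power of \<open>t\<close>
  (\<open>emeasure_slab_le\<close>, \<open>emeasure_max_region_le\<close>). For the layers this gives
  \<open>O(x powr (2 / (r + 2)))\<close> if \<open>r \<ge> 2\<close> and \<open>O(1)\<close> if \<open>r = 1\<close>,
  which is at most the stated error for \<open>x \<ge> 1\<close>. For \<open>x < 1\<close> no point is counted
  and the main term itself is small enough.\<close>

section \<open>Integrality of the Weyl dimension\<close>

text \<open>Expanding each \<open>P j\<close> in powers factors the evaluation matrix as the Vandermonde matrix
  times the coefficient matrix, which is upper triangular with unit diagonal. Hence every monic
  basis yields the same determinant. Two choices of basis matter below: Newton's basis at the nodes
  makes the matrix triangular, and the falling factorials turn its entries into multiples of
  binomial coefficients.\<close>

lemma det_eval_monic_basis: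
  fixes P :: "nat \<Rightarrow> 'a::idom poly" and x :: "nat \<Rightarrow> 'a"
  assumes deg: "\<And>j. j < n \<Longrightarrow> degree (P j) = j" and monic: "\<And>j. j < n \<Longrightarrow> lead_coeff (P j) = 1"
  shows "Determinant.det (Matrix.mat n n (\<lambda>(i, j). poly (P j) (x i))) =
    Determinant.det (Matrix.mat n n (\<lambda>(i, j). x i ^ j))"
proof -
  let ?U = "Matrix.mat n n (\<lambda>(i, j). coeff (P j) i)"
  let ?V = "Matrix.mat n n (\<lambda>(i, j). x i ^ j)"
  have "Matrix.mat n n (\<lambda>(i, j). poly (P j) (x i)) = ?V * ?U"
  proof (rule eq_matI)
    fix i j assume "i < dim_row (?V * ?U)" "j < dim_col (?V * ?U)"
    then have ij: "i < n" "j < n" by auto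
    have "poly (P j) (x i) = (\<Sum>k\<le>j. coeff (P j) k * x i ^ k)"
      using deg[OF ij(2)] by (simp add: poly_altdef)
    also have "\<dots> = (\<Sum>k<n. coeff (P j) k * x i ^ k)"
      using ij deg[OF ij(2)] by (intro sum.mono_neutral_left) (auto simp: coeff_eq_0)
    finally show "Matrix.mat n n (\<lambda>(i, j). poly (P j) (x i)) $$ (i, j) = (?V * ?U) $$ (i, j)"
      using ij by (simp add: scalar_prod_def atLeast0LessThan mult.commute)
  qed auto
  moreover have "Determinant.det ?U = 1"
  proof -
    have "Determinant.det ?U = prod_list (diag_mat ?U)"
      by (rule det_upper_triangular[where n = n]) (auto simp: deg coeff_eq_0)
    also have "\<dots> = (\<Prod>i<n. coeff (P i) i)"
      by (simp add: prod_list_diag_prod atLeast0LessThan)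
    also have "\<dots> = 1"
      using deg monic by (intro prod.neutral) auto
    finally show ?thesis .
  qed
  moreover have "Determinant.det (?V * ?U) = Determinant.det ?V * Determinant.det ?U"
    by (rule det_mult) auto
  ultimately show ?thesis by simp
qed

lemma degree_prod_linear_factors:
  fixes a :: "'i \<Rightarrow> 'a::idom"
  shows "degree (\<Prod>t\<in>A. [:- a t, 1:]) = card A" "lead_coeff (\<Prod>t\<in>A. [:- a t, 1:]) = 1"
proof -
  show "degree (\<Prod>t\<in>A. [:- a t, 1:]) = card A"
    by (subst degree_prod_eq_sum_degree) auto
  show "lead_coeff (\<Prod>t\<in>A. [:- a t, 1:]) = 1"
    by (simp only: lead_coeff_prod) simp
qed

text \<open>In Newton's basis \<open>\<Prod>t<j. (X - x t)\<close> the evaluation matrix at the nodes is lower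
  triangular, because the \<open>j\<close>-th basis polynomial vanishes at all earlier nodes.\<close>

lemma vandermonde_det:
  fixes x :: "nat \<Rightarrow> 'a::idom"
  shows "Determinant.det (Matrix.mat n n (\<lambda>(i, j). x i ^ j)) = (\<Prod>j<n. \<Prod>i<j. x j - x i)"
proof -
  define P where "P j = (\<Prod>t<j. [:- x t, 1:])" for j
  have P: "degree (P j) = j" "lead_coeff (P j) = 1" for j
    using degree_prod_linear_factors[of x "{..<j}"] by (auto simp: P_def)
  let ?L = "Matrix.mat n n (\<lambda>(i, j). poly (P j) (x i))"
  have "Determinant.det ?L = prod_list (diag_mat ?L)"
    by (rule det_lower_triangular[where n = n]) (auto simp: P_def poly_prod)
  also have "\<dots> = (\<Prod>j<n. \<Prod>i<j. x j - x i)"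
    by (simp add: prod_list_diag_prod atLeast0LessThan P_def poly_prod)
  finally show ?thesis
    using det_eval_monic_basis[of n P x] P by simp
qed

lemma falling_factorial_eq:
  "(\<Prod>t<j. int x - int t) = int (x choose j) * fact j"
proof -
  have "(of_int (\<Prod>t<j. int x - int t) :: rat) = (of_nat x gchoose j) * fact j"
    by (simp add: gbinomial_prod_rev atLeast0LessThan)
  also have "\<dots> = of_int (int (x choose j) * fact j)"
    by (simp add: binomial_gbinomial)
  finally show ?thesis by linarith
qed

text \<open>In the basis of falling factorials, column \<open>j\<close> of the evaluation matrix consists of
  \<open>fact j\<close> times binomial coefficients. So the Vandermonde determinant is the product of the
  \<open>fact j\<close> times the determinant of an integer matrix.\<close>

lemma superfactorial_dvd_prod_differences:
  fixes x :: "nat \<Rightarrow> nat"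
  shows "(\<Prod>j<n. fact j :: int) dvd (\<Prod>j<n. \<Prod>i<j. int (x j) - int (x i))"
proof -
  define P :: "nat \<Rightarrow> int poly" where "P j = (\<Prod>t<j. [:- int t, 1:])" for j
  have P: "degree (P j) = j" "lead_coeff (P j) = 1" for j
    using degree_prod_linear_factors[of int "{..<j}"] by (auto simp: P_def)
  let ?B = "Matrix.mat n n (\<lambda>(i, j). int (x i choose j))"
  let ?D = "Matrix.mat n n (\<lambda>(i, j). if i = j then fact j else (0 :: int))"
  have "Matrix.mat n n (\<lambda>(i, j). poly (P j) (int (x i))) = ?B * ?D"
  proof (rule eq_matI)
    fix i j assume "i < dim_row (?B * ?D)" "j < dim_col (?B * ?D)"
    then have ij: "i < n" "j < n" by auto
    have "(\<Sum>k<n. int (x i choose k) * (if k = j then fact j else 0)) = int (x i choose j) * fact j"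
      using ij by (simp add: if_distrib sum.delta cong: if_cong)
    then show "Matrix.mat n n (\<lambda>(i, j). poly (P j) (int (x i))) $$ (i, j) = (?B * ?D) $$ (i, j)"
      using ij by (simp add: scalar_prod_def atLeast0LessThan P_def poly_prod falling_factorial_eq)
  qed auto
  moreover have "Determinant.det ?D = (\<Prod>j<n. fact j)"
    by (subst det_upper_triangular[where n = n]) (auto simp: prod_list_diag_prod atLeast0LessThan)
  moreover have "Determinant.det (?B * ?D) = Determinant.det ?B * Determinant.det ?D"
    by (rule det_mult) auto
  ultimately have "(\<Prod>j<n. \<Prod>i<j. int (x j) - int (x i)) = Determinant.det ?B * (\<Prod>j<n. fact j)"
    using det_eval_monic_basis[of n P "\<lambda>i. int (x i)"] P vandermonde_det[of n "\<lambda>i. int (x i)"] by simp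
  then show ?thesis by simp
qed

text \<open>With the partial sums \<open>p j = k 1 + \<dots> + k j\<close> as nodes, the factor
  \<open>k l + \<dots> + k j\<close> is the difference \<open>p j - p (l - 1)\<close>, so the numerator is a
  product of differences of \<open>r + 1\<close> integers.\<close>

lemma dim_poly_in_Nats:
  fixes k :: "nat \<Rightarrow> nat"
  shows "dim_poly r (\<lambda>i. real (k i)) \<in> \<nat>"
proof -
  define p where "p j = (\<Sum>i=1..j. k i)" for j
  have gap: "int (p j) - int (p (l - 1)) = (\<Sum>i=l..j. int (k i))" if "l \<in> {1..j}" for l j
  proof -
    have "{1..j} = {1..l-1} \<union> {l..j}" "{1..l-1} \<inter> {l..j} = {}" using that by auto
    then have "p j = p (l - 1) + (\<Sum>i=l..j. k i)"
      by (simp add: p_def sum.union_disjoint)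
    then show ?thesis by simp
  qed
  have "(\<Prod>j=1..r. \<Prod>l=1..j. \<Sum>i=l..j. int (k i)) = (\<Prod>j=1..r. \<Prod>l=1..j. int (p j) - int (p (l - 1)))"
    by (intro prod.cong refl) (use gap in auto)
  also have "\<dots> = (\<Prod>j=1..r. \<Prod>l<j. int (p j) - int (p l))"
    by (intro prod.cong refl prod.reindex_bij_witness[where i = Suc and j = "\<lambda>l. l - 1"]) auto
  also have "\<dots> = (\<Prod>j<Suc r. \<Prod>l<j. int (p j) - int (p l))"
    by (intro prod.mono_neutral_left) (auto simp: not_less_eq_eq)
  finally have "(\<Prod>j<Suc r. fact j :: int) dvd (\<Prod>j=1..r. \<Prod>l=1..j. \<Sum>i=l..j. int (k i))"
    using superfactorial_dvd_prod_differences[of "Suc r" p] by simp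
  moreover have "(\<Prod>j<Suc r. fact j :: int) = (\<Prod>j=1..r. fact j)"
    by (intro prod.mono_neutral_right) (auto simp: not_less_eq_eq)
  ultimately obtain c where c: "(\<Prod>j=1..r. \<Prod>l=1..j. \<Sum>i=l..j. int (k i)) = (\<Prod>j=1..r. fact j) * c"
    by (auto elim: dvdE)
  have "real_of_int (\<Prod>j=1..r. \<Prod>l=1..j. \<Sum>i=l..j. int (k i)) = dim_const r * of_int c"
    unfolding c by (simp add: dim_const_def)
  then have "dim_poly r (\<lambda>i. real (k i)) = of_int c"
    using dim_const_pos[of r] by (simp add: dim_poly_def)
  moreover have "0 \<le> dim_poly r (\<lambda>i. real (k i))"
    unfolding dim_poly_def using dim_const_pos[of r]
    by (intro mult_nonneg_nonneg prod_nonneg sum_nonneg ballI) auto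
  ultimately show ?thesis
    by (metis Ints_of_int Nats_altdef2 mem_Collect_eq)
qed

section \<open>Volumes of regions bounded by products of maxima\<close>

interpretation lborel_PiM: product_sigma_finite "\<lambda>_ :: nat. lborel :: real measure"
  by standard

text \<open>For \<open>q = 1\<close> and \<open>I = {1..r}\<close> this is a minorant of the numerator of
  \<open>dim_poly\<close>, in which a sum over an interval is replaced by the maximum of its two end
  terms. If the coordinates are sorted decreasingly as
  \<open>M 1 \<ge> \<dots> \<ge> M n\<close>, it equals \<open>\<Prod>s. M s ^ (q + n - s)\<close>. The
  parameter \<open>q\<close> is what changes when a coordinate is split off.\<close>

definition max_form :: "nat \<Rightarrow> nat set \<Rightarrow> (nat \<Rightarrow> real) \<Rightarrow> real" where
  "max_form q I y = (\<Prod>i\<in>I. y i ^ q) * (\<Prod>j\<in>I. \<Prod>l\<in>{l\<in>I. l < j}. max (y l) (y j))"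

definition max_region :: "nat \<Rightarrow> nat set \<Rightarrow> real \<Rightarrow> (nat \<Rightarrow> real) set" where
  "max_region q I X = {y \<in> I \<rightarrow>\<^sub>E {0<..}. max_form q I y \<le> X}"

text \<open>The form \<open>max_form q I\<close> on \<open>n\<close> coordinates is homogeneous of degree
  \<open>n * q + n * (n - 1) / 2\<close>, so a finite volume of its sublevel sets has to grow with
  exponent \<open>n\<close> over this degree. For \<open>n = 0\<close> the convention
  \<open>0 / 0 = 0\<close> gives the correct value, as there is only one point.\<close>

definition volume_exponent :: "nat \<Rightarrow> nat \<Rightarrow> real" where
  "volume_exponent n q = real n / (real n * real q + real n * (real n - 1) / 2)"

lemma max_form_cong: "(\<And>i. i \<in> I \<Longrightarrow> y i = z i) \<Longrightarrow> max_form q I y = max_form q I z"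
  unfolding max_form_def by (intro arg_cong2[where f = "(*)"] prod.cong) auto

text \<open>The maxima that involve the new coordinate \<open>m\<close> are bounded from below by the other
  coordinate of the pair, which raises the exponent of each remaining coordinate by one. This
  turns the form with parameter \<open>q\<close> into the form with parameter \<open>Suc q\<close> in one
  variable less.\<close>

lemma max_form_insert_ge:
  assumes I: "finite I" "m \<notin> I" and pos: "\<And>i. i \<in> insert m I \<Longrightarrow> 0 < y i"
  shows "y m ^ q * max_form (Suc q) I y \<le> max_form q (insert m I) y"
proof -
  define f where "f = (\<lambda>(j, l). max (y l) (y j))"
  define pairs where "pairs J = (SIGMA j:J. {l\<in>J. l < j})" for J :: "nat set"
  define g where "g i = (max i m, min i m)" for i
  have form: "max_form p J y = (\<Prod>i\<in>J. y i ^ p) * prod f (pairs J)" if "finite J" for p J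
    unfolding max_form_def f_def pairs_def using that by (subst prod.Sigma) auto
  \<comment> \<open>The new pairs are indexed by \<open>I\<close>, up to the order of the two indices.\<close>
  have "pairs (insert m I) = pairs I \<union> g ` I"
    unfolding pairs_def g_def using I(2)
    by (auto simp: image_iff max_def min_def split: if_splits) (metis le_neq_implies_less less_imp_le not_le)+
  moreover have "pairs I \<inter> g ` I = {}"
    unfolding pairs_def g_def using I(2) by (auto simp: max_def min_def split: if_splits)
  moreover have "finite (pairs I)"
    unfolding pairs_def using I(1) by auto
  ultimately have "prod f (pairs (insert m I)) = prod f (pairs I) * prod f (g ` I)"
    using I(1) by (simp add: prod.union_disjoint)
  also have "prod f (g ` I) = (\<Prod>i\<in>I. max (y i) (y m))"
  proof -
    have "inj_on g I"
      using I(2) by (auto simp: inj_on_def g_def max_def min_def split: if_splits)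
    then show ?thesis
      by (subst prod.reindex) (auto simp: f_def g_def max_def min_def intro!: prod.cong)
  qed
  finally have pairs_insert: "prod f (pairs (insert m I)) = prod f (pairs I) * (\<Prod>i\<in>I. max (y i) (y m))" .
  have f_nonneg: "0 \<le> prod f (pairs I)"
    using pos by (intro prod_nonneg) (auto simp: f_def pairs_def le_max_iff_disj less_imp_le)
  have "y m ^ q * max_form (Suc q) I y
      = y m ^ q * (\<Prod>i\<in>I. y i ^ q) * prod f (pairs I) * (\<Prod>i\<in>I. y i)"
    using I(1) by (simp add: form prod.distrib)
  also have "\<dots> \<le> y m ^ q * (\<Prod>i\<in>I. y i ^ q) * prod f (pairs I) * (\<Prod>i\<in>I. max (y i) (y m))"
    using pos by (intro mult_left_mono prod_mono mult_nonneg_nonneg f_nonneg prod_nonneg) (auto simp: less_imp_le)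
  also have "\<dots> = max_form q (insert m I) y"
    using I by (simp add: form pairs_insert)
  finally show ?thesis .
qed

text \<open>Here \<open>d\<close> is the degree of the form. The hypothesis on \<open>d\<close> is the formula
  \<open>2 * d = n * (2 * q + n - 1)\<close> without subtraction.\<close>

lemma power_le_max_form:
  assumes "finite I" "0 < t" "\<And>i. i \<in> I \<Longrightarrow> t \<le> y i" "2 * d + card I = card I * (2 * q + card I)"
  shows "t ^ d \<le> max_form q I y"
  using assms
proof (induction I arbitrary: q d rule: finite_induct)
  case empty
  then show ?case by (simp add: max_form_def)
next
  case (insert m I)
  define d' where "d' = d - q"
  have c: "2 * d + card I + 1 = (card I + 1) * (2 * q + card I + 1)"
    using insert by simp
  then have "2 * d = 2 * q + card I * (2 * q + card I + 1)"
    by (simp add: algebra_simps)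
  then have d: "d = q + d'" "2 * d' + card I = card I * (2 * Suc q + card I)"
    by (simp_all add: d'_def algebra_simps)
  have "0 < y m" using insert.prems(1) insert.prems(2)[of m] by simp
  have "t ^ d = t ^ q * t ^ d'"
    by (simp add: d power_add)
  also have "\<dots> \<le> y m ^ q * max_form (Suc q) I y"
    using insert.IH[OF insert.prems(1) _ d(2)] insert.prems \<open>0 < y m\<close>
    by (intro mult_mono power_mono) (auto simp: less_imp_le)
  also have "\<dots> \<le> max_form q (insert m I) y"
    using insert.prems insert.hyps by (intro max_form_insert_ge) (auto intro: less_le_trans[of 0 t])
  finally show ?case .
qed

lemma max_form_measurable [measurable]:
  "finite I \<Longrightarrow> max_form q I \<in> borel_measurable (PiM I (\<lambda>_. lborel))"
  unfolding max_form_def [abs_def] by measurable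

lemma max_region_eq:
  "max_region q I X = {y \<in> space (PiM I (\<lambda>_. lborel)). (\<forall>i\<in>I. 0 < y i) \<and> max_form q I y \<le> X}"
  by (auto simp: max_region_def space_PiM PiE_iff)

lemma max_region_sets [measurable]:
  "finite I \<Longrightarrow> max_region q I X \<in> sets (PiM I (\<lambda>_. lborel))"
  unfolding max_region_eq by measurable

lemma slab_sets:
  fixes A :: "(nat \<Rightarrow> real) set"
  assumes "m \<in> I" "A \<in> sets (PiM I (\<lambda>_. lborel))"
  shows "{y \<in> A. y m \<le> T} \<in> sets (PiM I (\<lambda>_. lborel))"
proof -
  have "{y \<in> A. y m \<le> T} = A \<inter> {y \<in> space (PiM I (\<lambda>_. lborel)). y m \<le> T}"
    using sets.sets_into_space[OF assms(2)] by auto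
  then show ?thesis using assms by simp
qed

lemma nn_integral_powr_from_0:
  assumes "a > -1" "T \<ge> 0"
  shows "(\<integral>\<^sup>+t. ennreal (t powr a) * indicator {0..T} t \<partial>lborel) = ennreal (T powr (a + 1) / (a + 1))"
  using assms by (intro nn_integral_has_integral_lebesgue' has_integral_powr_from_0) auto

text \<open>Integrate over the distinguished coordinate last. For \<open>y m = t\<close> the slice lies in the
  sublevel set of the form in the other coordinates at level \<open>X / t ^ q\<close>; its volume is
  at most \<open>C * X powr e * t powr (- q * e)\<close>, which is integrable near 0 because
  \<open>q * e < 1\<close>. The lemma is used twice: with \<open>T\<close> the largest possible value of a
  smallest coordinate, to bound the volume of the whole sublevel set, and with \<open>T = 1\<close>, to
  bound the boundary layer in the lattice point count.\<close>

lemma emeasure_slab_le: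
  assumes I: "finite I" "m \<notin> I" and X: "0 < X" and T: "0 < T" and C: "0 \<le> C" and e: "real q * e < 1"
    and vol: "\<And>Z. 0 < Z \<Longrightarrow> emeasure (PiM I (\<lambda>_. lborel)) (max_region (Suc q) I Z) \<le> ennreal (C * Z powr e)"
  shows "emeasure (PiM (insert m I) (\<lambda>_. lborel)) {y \<in> max_region q (insert m I) X. y m \<le> T}
    \<le> ennreal (C * X powr e * (T powr (1 - real q * e) / (1 - real q * e)))"
proof -
  let ?S = "{y \<in> max_region q (insert m I) X. y m \<le> T}"
  have [measurable]: "?S \<in> sets (PiM (insert m I) (\<lambda>_. lborel))"
    using I(1) by (intro slab_sets max_region_sets) auto
  have inner: "(\<integral>\<^sup>+x. indicator ?S (x(m := t)) \<partial>(PiM I (\<lambda>_. lborel)))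
      \<le> ennreal (C * X powr e) * (ennreal (t powr (- (real q * e))) * indicator {0..T} t)" for t
  proof (cases "0 < t \<and> t \<le> T")
    case True
    then have t: "0 < t" "t \<le> T" by auto
    have "(\<integral>\<^sup>+x. indicator ?S (x(m := t)) \<partial>(PiM I (\<lambda>_. lborel)))
        \<le> (\<integral>\<^sup>+x. indicator (max_region (Suc q) I (X / t ^ q)) x \<partial>(PiM I (\<lambda>_. lborel)))"
    proof (intro nn_integral_mono)
      fix x :: "nat \<Rightarrow> real"
      assume x: "x \<in> space (PiM I (\<lambda>_. lborel))"
      show "(indicator ?S (x(m := t)) :: ennreal) \<le> indicator (max_region (Suc q) I (X / t ^ q)) x"
      proof (cases "x(m := t) \<in> ?S")
        case True
        then have y: "\<And>i. i \<in> insert m I \<Longrightarrow> 0 < (x(m := t)) i" "max_form q (insert m I) (x(m := t)) \<le> X"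
          by (auto simp: max_region_def PiE_iff)
        have "max_form (Suc q) I (x(m := t)) = max_form (Suc q) I x"
          using I(2) by (intro max_form_cong) auto
        then have "t ^ q * max_form (Suc q) I x \<le> X"
          using max_form_insert_ge[of I m "x(m := t)" q, OF I y(1)] y(2) by simp
        moreover have "0 < x i" if "i \<in> I" for i
          using y(1)[of i] that I(2) by (auto split: if_splits)
        then have "x \<in> I \<rightarrow>\<^sub>E {0<..}"
          using x by (auto simp: space_PiM PiE_iff)
        ultimately have "x \<in> max_region (Suc q) I (X / t ^ q)"
          using t by (simp add: max_region_def field_simps)
        then show ?thesis by (auto simp: indicator_def)
      qed simp
    qed
    also have "\<dots> = emeasure (PiM I (\<lambda>_. lborel)) (max_region (Suc q) I (X / t ^ q))"
      using I(1) by simp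
    also have "\<dots> \<le> ennreal (C * (X / t ^ q) powr e)"
      using X t by (intro vol) auto
    also have "(X / t ^ q) powr e = X powr e * t powr (- (real q * e))"
      using X t by (simp add: powr_divide powr_realpow[symmetric] powr_powr powr_minus_divide)
    also have "ennreal (C * (X powr e * t powr (- (real q * e))))
        = ennreal (C * X powr e) * (ennreal (t powr (- (real q * e))) * indicator {0..T} t)"
      using t C by (simp add: ennreal_mult' mult.assoc)
    finally show ?thesis .
  next
    case False
    then have "x(m := t) \<notin> ?S" for x
      by (auto simp: max_region_def PiE_iff)
    then show ?thesis by simp
  qed
  have "emeasure (PiM (insert m I) (\<lambda>_. lborel)) ?S
      = (\<integral>\<^sup>+y. indicator ?S y \<partial>(PiM (insert m I) (\<lambda>_. lborel)))"
    by simp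
  also have "\<dots> = (\<integral>\<^sup>+t. (\<integral>\<^sup>+x. indicator ?S (x(m := t)) \<partial>(PiM I (\<lambda>_. lborel))) \<partial>lborel)"
    using I by (intro lborel_PiM.product_nn_integral_insert_rev) auto
  also have "\<dots> \<le> (\<integral>\<^sup>+t. ennreal (C * X powr e) * (ennreal (t powr (- (real q * e))) * indicator {0..T} t) \<partial>lborel)"
    by (intro nn_integral_mono inner)
  also have "\<dots> = ennreal (C * X powr e) * ennreal (T powr (1 - real q * e) / (1 - real q * e))"
    using nn_integral_powr_from_0[of "- (real q * e)" T] e T by (simp add: nn_integral_cmult)
  also have "\<dots> = ennreal (C * X powr e * (T powr (1 - real q * e) / (1 - real q * e)))"
    using C e by (subst ennreal_mult) auto
  finally show ?thesis .
qed

lemma volume_exponent_Suc: "volume_exponent (Suc n) q = 2 / (2 * real q + real n)"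
proof -
  have "volume_exponent (Suc n) q = (real n + 1) * 1 / ((real n + 1) * ((2 * real q + real n) / 2))"
    by (simp add: volume_exponent_def field_simps)
  also have "\<dots> = 2 / (2 * real q + real n)"
    by (subst mult_divide_mult_cancel_left) auto
  finally show ?thesis .
qed

lemma mult_volume_exponent_Suc_less_1: "real q * volume_exponent n (Suc q) < 1"
proof (cases n)
  case (Suc k)
  have "volume_exponent n (Suc q) = 2 / (2 * real q + 2 + real k)"
    using volume_exponent_Suc[of k "Suc q"] Suc by simp
  then show ?thesis by (simp only: times_divide_eq_right) (simp add: divide_less_eq)
qed (simp add: volume_exponent_def)

text \<open>The exponent of \<open>X\<close> that results from \<open>emeasure_slab_le\<close> when \<open>T\<close> is
  \<open>X\<close> to the power one over the degree of the form.\<close>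

lemma volume_exponent_step:
  assumes "1 \<le> q"
  shows "volume_exponent n (Suc q) + (1 - real q * volume_exponent n (Suc q)) * (2 / ((real n + 1) * (2 * real q + real n)))
    = volume_exponent (Suc n) q"
proof (cases n)
  case (Suc k)
  define A where "A = 2 * real q + real n"
  have A: "A > 0" "2 * real q = A - real n" using assms by (auto simp: A_def)
  have g: "volume_exponent n (Suc q) = 2 / (A + 1)"
    using volume_exponent_Suc[of k "Suc q"] Suc by (simp add: A_def algebra_simps)
  have h: "1 - real q * (2 / (A + 1)) = (real n + 1) / (A + 1)"
    using A by (simp add: field_simps)
  have "(real n + 1) / (A + 1) * (2 / ((real n + 1) * A)) = 2 / ((A + 1) * A)"
    by (simp add: divide_simps)
  then show ?thesis
    unfolding volume_exponent_Suc g h A_def[symmetric] using A(1)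
    by (simp add: divide_simps) (simp add: algebra_simps)
next
  case 0
  then show ?thesis using assms by (simp add: volume_exponent_Suc) (simp add: volume_exponent_def)
qed

text \<open>Induction on the number of coordinates. The smallest coordinate of a point of the sublevel set is
  at most \<open>T = X powr (1 / degree)\<close>, so the set is covered by the slabs
  \<open>y m \<le> T\<close>, one for each coordinate \<open>m\<close>; each is controlled by
  \<open>emeasure_slab_le\<close> and the induction hypothesis for \<open>Suc q\<close>.\<close>

lemma emeasure_max_region_le:
  assumes "finite I" "1 \<le> q"
  shows "\<exists>C\<ge>0. \<forall>X>0. emeasure (PiM I (\<lambda>_. lborel)) (max_region q I X)
    \<le> ennreal (C * X powr volume_exponent (card I) q)"
  using assms
proof (induction "card I" arbitrary: I q)
  case 0
  then have [simp]: "I = {}" by simp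
  have "emeasure (PiM {} (\<lambda>_::nat. lborel :: real measure)) A \<le> ennreal 1" for A
    using emeasure_space[of "PiM {} (\<lambda>_. lborel)" A] by (simp add: space_PiM PiM_empty)
  then show ?case by (intro exI[of _ 1]) (auto simp: volume_exponent_def)
next
  case (Suc n)
  let ?e = "volume_exponent n (Suc q)"
  have card: "card (I - {m}) = n" if "m \<in> I" for m
    using Suc that by simp
  have "\<forall>m\<in>I. \<exists>C\<ge>0. \<forall>X>0. emeasure (PiM (I - {m}) (\<lambda>_. lborel)) (max_region (Suc q) (I - {m}) X)
      \<le> ennreal (C * X powr ?e)"
    using Suc.hyps(1)[OF card[symmetric], of _ "Suc q"] Suc.prems card by simp
  then obtain C where C: "\<And>m. m \<in> I \<Longrightarrow> 0 \<le> C m"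
    "\<And>m X. m \<in> I \<Longrightarrow> 0 < X \<Longrightarrow> emeasure (PiM (I - {m}) (\<lambda>_. lborel)) (max_region (Suc q) (I - {m}) X)
      \<le> ennreal (C m * X powr ?e)"
    by metis
  define b where "b = 1 - real q * ?e"
  have b: "0 < b" using mult_volume_exponent_Suc_less_1[of q n] by (simp add: b_def)
  \<comment> \<open>The reciprocal of the degree of the form in \<open>Suc n\<close> coordinates.\<close>
  define c where "c = 2 / ((real n + 1) * (2 * real q + real n))"
  have bound: "emeasure (PiM I (\<lambda>_. lborel)) (max_region q I X)
      \<le> ennreal ((\<Sum>m\<in>I. C m / b) * X powr volume_exponent (card I) q)" if X: "0 < X" for X
  proof -
    define T where "T = X powr c"
    define slab where "slab m = {y \<in> max_region q I X. y m \<le> T}" for m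
    have T: "0 < T" using X by (simp add: T_def)
    have slab_le: "emeasure (PiM I (\<lambda>_. lborel)) (slab m) \<le> ennreal (C m / b * X powr volume_exponent (card I) q)"
      if m: "m \<in> I" for m
    proof -
      have "emeasure (PiM I (\<lambda>_. lborel)) (slab m) \<le> ennreal (C m * X powr ?e * (T powr b / b))"
        using emeasure_slab_le[of "I - {m}" m X T "C m" q ?e] m X T C Suc.prems mult_volume_exponent_Suc_less_1[of q n]
        by (simp add: insert_absorb slab_def b_def)
      also have "X powr ?e * T powr b = X powr (?e + b * c)"
        by (simp add: T_def powr_powr powr_add mult.commute)
      then have "C m * X powr ?e * (T powr b / b) = C m / b * X powr volume_exponent (card I) q"
        using volume_exponent_step[OF Suc.prems(2), of n] Suc.hyps(2)
        by (simp add: b_def[symmetric] c_def[symmetric])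
      finally show ?thesis .
    qed
    have sets: "slab m \<in> sets (PiM I (\<lambda>_. lborel))" if m: "m \<in> I" for m
      unfolding slab_def using Suc.prems m by (intro slab_sets max_region_sets) auto
    have "max_region q I X \<subseteq> (\<Union>m\<in>I. slab m)"
    proof
      fix y assume y: "y \<in> max_region q I X"
      have I_ne: "I \<noteq> {}" using Suc.hyps(2) by auto
      obtain m where m: "m \<in> I" "\<And>i. i \<in> I \<Longrightarrow> y m \<le> y i"
        using arg_min_if_finite[OF Suc.prems(1) I_ne, of y] by (metis not_le)
      have ym: "0 < y m" using y m by (auto simp: max_region_def PiE_iff)
      \<comment> \<open>The degree of the form; the division is exact because \<open>card I = Suc n\<close>.\<close>
      define d where "d = card I * (2 * q + n) div 2"
      have "even (card I * (2 * q + n))" using Suc.hyps(2)[symmetric] by simp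
      then have d: "2 * d = card I * (2 * q + n)" by (simp add: d_def)
      then have "2 * d + card I = card I * (2 * q + card I)"
        using Suc.hyps(2)[symmetric] by (simp add: algebra_simps)
      then have "y m ^ d \<le> max_form q I y"
        using ym m Suc.prems(1) by (intro power_le_max_form) auto
      also have "\<dots> \<le> X" using y by (simp add: max_region_def)
      finally have "(y m ^ d) powr c \<le> T"
        unfolding T_def using ym Suc.prems by (intro powr_mono2) (auto simp: c_def)
      moreover have "real d * c = 1"
      proof -
        have "2 * real d = (real n + 1) * (2 * real q + real n)"
          using arg_cong[OF d, of real] Suc.hyps(2)[symmetric] by (simp add: algebra_simps)
        moreover have "0 < 2 * real q + real n"
          using Suc.prems by simp
        ultimately show ?thesis by (simp add: c_def)
      qed
      ultimately have "y m \<le> T"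
        using ym by (simp add: powr_realpow[symmetric] powr_powr)
      then show "y \<in> (\<Union>m\<in>I. slab m)" using y m by (auto simp: slab_def)
    qed
    then have "emeasure (PiM I (\<lambda>_. lborel)) (max_region q I X)
        \<le> emeasure (PiM I (\<lambda>_. lborel)) (\<Union>m\<in>I. slab m)"
      using sets Suc.prems by (intro emeasure_mono) auto
    also have "\<dots> \<le> (\<Sum>m\<in>I. emeasure (PiM I (\<lambda>_. lborel)) (slab m))"
      using sets Suc.prems by (intro emeasure_subadditive_finite) auto
    also have "\<dots> \<le> (\<Sum>m\<in>I. ennreal (C m / b * X powr volume_exponent (card I) q))"
      by (intro sum_mono slab_le)
    also have "\<dots> = ennreal ((\<Sum>m\<in>I. C m / b) * X powr volume_exponent (card I) q)"
      using C b by (subst sum_ennreal) (auto simp: sum_distrib_right)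
    finally show ?thesis .
  qed
  then show ?case
    using C b by (intro exI[of _ "\<Sum>m\<in>I. C m / b"]) (auto intro!: sum_nonneg)
qed

section \<open>Scaling of the product Lebesgue measure\<close>

lemma lborel_PiM_scale:
  fixes I :: "nat set"
  assumes I: "finite I" and s: "0 < s"
  shows "PiM I (\<lambda>_. lborel) = scale_measure (ennreal (s ^ card I))
    (distr (PiM I (\<lambda>_. lborel)) (PiM I (\<lambda>_. lborel)) (\<lambda>y. \<lambda>i\<in>I. s * y i))" (is "_ = ?P")
proof (rule lborel_PiM.PiM_eqI[OF I, symmetric])
  fix A :: "nat \<Rightarrow> real set" assume A: "\<And>i. i \<in> I \<Longrightarrow> A i \<in> sets lborel"
  have line: "ennreal s * emeasure lborel ((\<lambda>t. s * t) -` B) = emeasure lborel B" if B: "B \<in> sets lborel" for B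
    by (subst (2) lborel_distr_mult'[of s])
      (use s B in \<open>simp_all add: emeasure_density nn_integral_cmult_indicator emeasure_distr\<close>)
  have preimage: "(\<lambda>t. s * t) -` A i \<in> sets lborel" if "i \<in> I" for i
    using measurable_sets[of "\<lambda>t. s * t" borel borel "A i"] A[OF that] by simp
  have "?P (Pi\<^sub>E I A) = ennreal (s ^ card I) * emeasure (PiM I (\<lambda>_. lborel))
      ((\<lambda>y. \<lambda>i\<in>I. s * y i) -` Pi\<^sub>E I A \<inter> space (PiM I (\<lambda>_. lborel)))"
    using I A by (subst emeasure_scale_measure, subst emeasure_distr) (auto intro!: sets_PiM_I_finite)
  also have "(\<lambda>y. \<lambda>i\<in>I. s * y i) -` Pi\<^sub>E I A \<inter> space (PiM I (\<lambda>_. lborel)) = (\<Pi>\<^sub>E i\<in>I. (\<lambda>t. s * t) -` A i)"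
    by (auto simp: space_PiM PiE_iff)
  also have "emeasure (PiM I (\<lambda>_. lborel)) \<dots> = (\<Prod>i\<in>I. emeasure lborel ((\<lambda>t. s * t) -` A i))"
    using I preimage by (intro lborel_PiM.emeasure_PiM) auto
  also have "ennreal (s ^ card I) * \<dots> = (\<Prod>i\<in>I. ennreal s * emeasure lborel ((\<lambda>t. s * t) -` A i))"
    using s by (simp add: prod.distrib ennreal_power)
  also have "\<dots> = (\<Prod>i\<in>I. emeasure lborel (A i))"
    using A by (intro prod.cong refl line)
  finally show "?P (Pi\<^sub>E I A) = (\<Prod>i\<in>I. emeasure lborel (A i))" .
qed simp

section \<open>Sublevel sets of the dimension polynomial\<close>

definition dim_sublevel :: "nat \<Rightarrow> real \<Rightarrow> (nat \<Rightarrow> real) set" where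
  "dim_sublevel r x = {y \<in> {1..r} \<rightarrow>\<^sub>E {0<..}. dim_poly r y \<le> x}"

lemma dim_sublevel_sets [measurable]: "dim_sublevel r x \<in> sets (PiM {1..r} (\<lambda>_. lborel))"
proof -
  have eq: "dim_sublevel r x = {y \<in> space (PiM {1..r} (\<lambda>_. lborel)). (\<forall>i\<in>{1..r}. 0 < y i) \<and> dim_poly r y \<le> x}"
    by (auto simp: dim_sublevel_def space_PiM PiE_iff)
  have "(\<lambda>y. \<Sum>i=l..j. y i) \<in> borel_measurable (PiM {1..r} (\<lambda>_. lborel :: real measure))"
    if "l \<in> {1..j}" "j \<in> {1..r}" for l j
    using that by (intro borel_measurable_sum) auto
  then have [measurable]: "dim_poly r \<in> borel_measurable (PiM {1..r} (\<lambda>_. lborel))"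
    unfolding dim_poly_def [abs_def]
    by (intro borel_measurable_times borel_measurable_const borel_measurable_prod)
  show ?thesis
    unfolding eq by measurable
qed

lemma dim_poly_pos:
  assumes "\<And>i. i \<in> {1..r} \<Longrightarrow> 0 < y i"
  shows "0 < dim_poly r y"
  unfolding dim_poly_def using dim_const_pos[of r] assms
  by (intro mult_pos_pos divide_pos_pos prod_pos sum_pos) auto

lemma dim_poly_mono:
  assumes "\<And>i. i \<in> {1..r} \<Longrightarrow> 0 \<le> y i" "\<And>i. i \<in> {1..r} \<Longrightarrow> y i \<le> z i"
  shows "dim_poly r y \<le> dim_poly r z"
  unfolding dim_poly_def using dim_const_pos[of r] assms
  by (intro mult_left_mono prod_mono conjI sum_nonneg prod_nonneg ballI sum_mono) auto

lemma dim_poly_scale: "dim_poly r (\<lambda>i. s * y i) = s ^ (\<Sum>{1..r}) * dim_poly r y"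
proof -
  have "(\<Prod>j=1..r. \<Prod>l=1..j. \<Sum>i=l..j. s * y i) = (\<Prod>j=1..r. s ^ j * (\<Prod>l=1..j. \<Sum>i=l..j. y i))"
    by (simp add: sum_distrib_left[symmetric] prod.distrib)
  also have "\<dots> = s ^ (\<Sum>{1..r}) * (\<Prod>j=1..r. \<Prod>l=1..j. \<Sum>i=l..j. y i)"
    by (simp add: prod.distrib power_sum)
  finally show ?thesis by (simp add: dim_poly_def)
qed

lemma dim_poly_cong: "(\<And>i. i \<in> {1..r} \<Longrightarrow> y i = z i) \<Longrightarrow> dim_poly r y = dim_poly r z"
  unfolding dim_poly_def by (intro arg_cong2[where f = "(*)"] prod.cong sum.cong) auto

text \<open>The interval sum \<open>y l + \<dots> + y j\<close> dominates both of its end terms.\<close>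

lemma max_form_le_dim_poly:
  assumes pos: "\<And>i. i \<in> {1..r} \<Longrightarrow> 0 < y i"
  shows "max_form 1 {1..r} y \<le> dim_const r * dim_poly r y"
proof -
  have "max_form 1 {1..r} y = (\<Prod>j=1..r. y j * (\<Prod>l\<in>{1..<j}. max (y l) (y j)))"
    unfolding max_form_def prod.distrib
    by (intro arg_cong2[where f = "(*)"] prod.cong) auto
  also have "\<dots> \<le> (\<Prod>j=1..r. \<Prod>l=1..j. \<Sum>i=l..j. y i)"
  proof (intro prod_mono conjI)
    fix j assume j: "j \<in> {1..r}"
    show "0 \<le> y j * (\<Prod>l\<in>{1..<j}. max (y l) (y j))"
      using pos j by (intro mult_nonneg_nonneg prod_nonneg) (auto simp: le_max_iff_disj less_imp_le)
    have "y j * (\<Prod>l\<in>{1..<j}. max (y l) (y j)) \<le> y j * (\<Prod>l\<in>{1..<j}. \<Sum>i=l..j. y i)"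
    proof (intro mult_left_mono prod_mono conjI)
      fix l assume l: "l \<in> {1..<j}"
      have "y i \<le> (\<Sum>i=l..j. y i)" if "i \<in> {l..j}" for i
        using that l j pos by (intro member_le_sum) (auto simp: less_imp_le)
      from this[of l] this[of j] l show "max (y l) (y j) \<le> (\<Sum>i=l..j. y i)" by auto
      show "0 \<le> max (y l) (y j)" using pos[OF j] by auto
    qed (use pos[OF j] in auto)
    also have "\<dots> = (\<Prod>l=1..j. \<Sum>i=l..j. y i)"
    proof -
      have "{1..j} = insert j {1..<j}" using j by auto
      then show ?thesis by simp
    qed
    finally show "y j * (\<Prod>l\<in>{1..<j}. max (y l) (y j)) \<le> (\<Prod>l=1..j. \<Sum>i=l..j. y i)" .
  qed
  also have "\<dots> = dim_const r * dim_poly r y"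
    using dim_const_pos[of r] by (simp add: dim_poly_def)
  finally show ?thesis .
qed

lemma dim_sublevel_subset_max_region:
  "dim_sublevel r x \<subseteq> max_region 1 {1..r} (dim_const r * x)"
proof
  fix y assume y: "y \<in> dim_sublevel r x"
  then have "max_form 1 {1..r} y \<le> dim_const r * dim_poly r y"
    by (intro max_form_le_dim_poly) (auto simp: dim_sublevel_def PiE_iff)
  also have "\<dots> \<le> dim_const r * x"
    using y dim_const_pos[of r] by (auto simp: dim_sublevel_def)
  finally show "y \<in> max_region 1 {1..r} (dim_const r * x)"
    using y by (auto simp: dim_sublevel_def max_region_def)
qed

lemma emeasure_dim_sublevel_finite:
  assumes "0 < x"
  shows "emeasure (PiM {1..r} (\<lambda>_. lborel)) (dim_sublevel r x) < \<infinity>"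
proof -
  obtain C where C: "\<And>X. 0 < X \<Longrightarrow> emeasure (PiM {1..r} (\<lambda>_. lborel)) (max_region 1 {1..r} X)
      \<le> ennreal (C * X powr volume_exponent (card {1..r}) 1)"
    using emeasure_max_region_le[of "{1..r}" 1] by auto
  have "emeasure (PiM {1..r} (\<lambda>_. lborel)) (dim_sublevel r x)
      \<le> emeasure (PiM {1..r} (\<lambda>_. lborel)) (max_region 1 {1..r} (dim_const r * x))"
    by (intro emeasure_mono dim_sublevel_subset_max_region max_region_sets) auto
  also have "\<dots> \<le> ennreal (C * (dim_const r * x) powr volume_exponent (card {1..r}) 1)"
    using assms dim_const_pos[of r] by (intro C) auto
  also have "\<dots> < \<infinity>" by simp
  finally show ?thesis .
qed

text \<open>The layer of the sublevel set along a coordinate hyperplane, as an instance of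
  \<open>emeasure_slab_le\<close> with \<open>q = 1\<close>. Its growth is that of the form with parameter 2 in
  the remaining \<open>r - 1\<close> coordinates.\<close>

lemma emeasure_dim_sublevel_slab_le:
  assumes r: "1 \<le> r"
  shows "\<exists>C. \<forall>x>0. \<forall>i\<in>{1..r}. emeasure (PiM {1..r} (\<lambda>_. lborel)) {y \<in> dim_sublevel r x. y i \<le> 1}
    \<le> ennreal (C * x powr volume_exponent (r - 1) 2)"
proof -
  let ?e = "volume_exponent (r - 1) 2"
  have e: "?e < 1" using mult_volume_exponent_Suc_less_1[of 1 "r - 1"] by (simp add: numeral_2_eq_2)
  have card: "card ({1..r} - {i}) = r - 1" if "i \<in> {1..r}" for i
    using that by simp
  have "\<exists>C\<ge>0. \<forall>X>0. emeasure (PiM ({1..r} - {i}) (\<lambda>_. lborel)) (max_region 2 ({1..r} - {i}) X)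
      \<le> ennreal (C * X powr ?e)" if "i \<in> {1..r}" for i
    using emeasure_max_region_le[of "{1..r} - {i}" 2] card[OF that] by simp
  then obtain C where C: "\<And>i. i \<in> {1..r} \<Longrightarrow> 0 \<le> C i"
    "\<And>i X. i \<in> {1..r} \<Longrightarrow> 0 < X \<Longrightarrow>
      emeasure (PiM ({1..r} - {i}) (\<lambda>_. lborel)) (max_region 2 ({1..r} - {i}) X) \<le> ennreal (C i * X powr ?e)"
    by metis
  \<comment> \<open>Summing the constants makes the bound uniform in \<open>i\<close>.\<close>
  define K where "K = (\<Sum>i=1..r. C i) * dim_const r powr ?e / (1 - ?e)"
  have "emeasure (PiM {1..r} (\<lambda>_. lborel)) {y \<in> dim_sublevel r x. y i \<le> 1} \<le> ennreal (K * x powr ?e)"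
    if x: "0 < x" and i: "i \<in> {1..r}" for x i
  proof -
    let ?X = "dim_const r * x"
    have X: "0 < ?X" using x dim_const_pos[of r] by simp
    have "emeasure (PiM {1..r} (\<lambda>_. lborel)) {y \<in> dim_sublevel r x. y i \<le> 1}
        \<le> emeasure (PiM {1..r} (\<lambda>_. lborel)) {y \<in> max_region 1 {1..r} ?X. y i \<le> 1}"
      using dim_sublevel_subset_max_region[of r x] i by (intro emeasure_mono slab_sets max_region_sets) auto
    also have "\<dots> \<le> ennreal (C i * ?X powr ?e * (1 powr (1 - ?e) / (1 - ?e)))"
      using emeasure_slab_le[of "{1..r} - {i}" i ?X 1 "C i" 1 ?e] X C i e
      by (simp add: insert_absorb numeral_2_eq_2)
    also have "C i * ?X powr ?e * (1 powr (1 - ?e) / (1 - ?e)) \<le> K * x powr ?e"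
    proof -
      have "C i \<le> (\<Sum>i=1..r. C i)"
        using C(1) i by (intro member_le_sum) auto
      then have "C i * (dim_const r powr ?e * x powr ?e / (1 - ?e))
          \<le> (\<Sum>i=1..r. C i) * (dim_const r powr ?e * x powr ?e / (1 - ?e))"
        using e by (intro mult_right_mono) auto
      then show ?thesis
        using x dim_const_pos[of r] by (simp add: K_def powr_mult)
    qed
    finally show ?thesis by (simp add: ennreal_leI)
  qed
  then show ?thesis by blast
qed

text \<open>The dimension polynomial is homogeneous of degree \<open>r * (r + 1) / 2\<close>, so the sublevel set
  is the dilation of \<open>dim_region r\<close> by the factor \<open>x powr (2 / (r * (r + 1)))\<close>.\<close>

lemma measure_dim_sublevel:
  assumes x: "0 < x" and r: "1 \<le> r"
  shows "measure (PiM {1..r} (\<lambda>_. lborel)) (dim_sublevel r x) =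
    x powr (2 / (real r + 1)) * measure (PiM {1..r} (\<lambda>_. lborel)) (dim_region r)"
proof -
  let ?M = "PiM {1..r} (\<lambda>_. lborel :: real measure)"
  define d where "d = \<Sum>{1..r}"
  have d: "2 * real d = real r * (real r + 1)"
  proof -
    have "2 * d = r * (r + 1)"
      unfolding d_def by (induction r) auto
    from arg_cong[OF this, of real] show ?thesis by (simp add: algebra_simps)
  qed
  have "0 < real r * (real r + 1)" using r by simp
  then have d0: "real d \<noteq> 0" using d by linarith
  define s where "s = x powr (1 / real d)"
  have s: "0 < s" using x by (simp add: s_def)
  have sd: "s ^ d = x"
    using x d0 by (simp add: s_def powr_powr flip: powr_realpow)
  have sr: "s ^ r = x powr (2 / (real r + 1))"
  proof -
    have "real r / real d = 2 / (real r + 1)"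
      using d d0 r by (simp add: field_simps)
    then show ?thesis
      using x by (simp add: s_def powr_powr flip: powr_realpow)
  qed
  have preimage: "(\<lambda>y. \<lambda>i\<in>{1..r}. s * y i) -` dim_sublevel r x \<inter> space ?M = dim_region r"
  proof -
    have "dim_poly r (\<lambda>i\<in>{1..r}. s * y i) = x * dim_poly r y" for y
      using dim_poly_scale[of r s y] dim_poly_cong[of r "\<lambda>i\<in>{1..r}. s * y i" "\<lambda>i. s * y i"] sd
      by (simp add: d_def)
    then show ?thesis
      using s x by (auto simp: dim_sublevel_def dim_region_def space_PiM PiE_iff extensional_def zero_less_mult_iff)
  qed
  have "emeasure ?M (dim_sublevel r x) = ennreal (s ^ r) * emeasure ?M (dim_region r)"
    by (subst lborel_PiM_scale[OF _ s], simp, subst emeasure_scale_measure, subst emeasure_distr)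
      (use preimage dim_sublevel_sets[of r x] in auto)
  then show ?thesis
    using s by (simp add: measure_def enn2real_mult sr)
qed

section \<open>Counting lattice points\<close>

text \<open>Dimensions are positive integers, so no weight with \<open>dim_poly r k \<le> x\<close> is missed by a
  sum over positive integers \<open>m \<le> x\<close>.\<close>

lemma num_irreps_upto_eq:
  shows "finite {k \<in> {1..r} \<rightarrow>\<^sub>E {1..}. dim_poly r (\<lambda>i. real (k i)) \<le> x}"
    and "num_irreps_upto r x = card {k \<in> {1..r} \<rightarrow>\<^sub>E {1..}. dim_poly r (\<lambda>i. real (k i)) \<le> x}"
proof -
  let ?M = "{m. 1 \<le> m \<and> real m \<le> x}"
  have eq: "{k \<in> {1..r} \<rightarrow>\<^sub>E {1..}. dim_poly r (\<lambda>i. real (k i)) \<le> x} = (\<Union>m\<in>?M. highest_weights r m)"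
  proof (intro equalityI subsetI)
    fix k assume k: "k \<in> {k \<in> {1..r} \<rightarrow>\<^sub>E {1..}. dim_poly r (\<lambda>i. real (k i)) \<le> x}"
    obtain m where m: "dim_poly r (\<lambda>i. real (k i)) = real m"
      using dim_poly_in_Nats[of r k] by (auto elim: Nats_cases)
    have "1 \<le> k i" if "i \<in> {1..r}" for i
      using k that by (auto simp: PiE_iff)
    then have "0 < dim_poly r (\<lambda>i. real (k i))"
      by (intro dim_poly_pos) (simp add: Suc_le_eq)
    then have "m \<in> ?M" using k m by auto
    then show "k \<in> (\<Union>m\<in>?M. highest_weights r m)"
      using k m by (auto simp: highest_weights_def)
  qed (auto simp: highest_weights_def)
  show "finite {k \<in> {1..r} \<rightarrow>\<^sub>E {1..}. dim_poly r (\<lambda>i. real (k i)) \<le> x}"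
    unfolding eq using finite_dimensions_upto[of x] finite_highest_weights by blast
  show "num_irreps_upto r x = card {k \<in> {1..r} \<rightarrow>\<^sub>E {1..}. dim_poly r (\<lambda>i. real (k i)) \<le> x}"
    unfolding eq num_irreps_upto_def num_irreps_def
    by (subst card_UN_disjoint)
      (use finite_dimensions_upto[of x] finite_highest_weights in \<open>auto simp: highest_weights_def\<close>)
qed

lemma emeasure_unit_cubes:
  fixes I :: "nat set"
  assumes I: "finite I" and K: "finite K" "K \<subseteq> I \<rightarrow>\<^sub>E UNIV"
  shows "(\<Union>k\<in>K. \<Pi>\<^sub>E i\<in>I. {real (k i) + c <.. real (k i) + c + 1}) \<in> sets (PiM I (\<lambda>_. lborel))"
    and "emeasure (PiM I (\<lambda>_. lborel)) (\<Union>k\<in>K. \<Pi>\<^sub>E i\<in>I. {real (k i) + c <.. real (k i) + c + 1}) = of_nat (card K)"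
proof -
  let ?Q = "\<lambda>k. \<Pi>\<^sub>E i\<in>I. {real (k i) + c <.. real (k i) + c + 1}"
  have sets: "?Q k \<in> sets (PiM I (\<lambda>_. lborel))" for k
    using I by (intro sets_PiM_I_finite) auto
  then show "(\<Union>k\<in>K. ?Q k) \<in> sets (PiM I (\<lambda>_. lborel))"
    using K by auto
  have disj: "disjoint_family_on ?Q K"
    unfolding disjoint_family_on_def
  proof (intro ballI impI)
    fix k k' assume k: "k \<in> K" "k' \<in> K" "k \<noteq> k'"
    then have "\<exists>i\<in>I. k i \<noteq> k' i" using K(2) by (metis PiE_ext subsetD)
    then obtain i where i: "i \<in> I" "k i \<noteq> k' i" by blast
    show "?Q k \<inter> ?Q k' = {}"
    proof (rule ccontr)
      assume "?Q k \<inter> ?Q k' \<noteq> {}"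
      then obtain y where "y \<in> ?Q k" "y \<in> ?Q k'" by blast
      then have "y i \<in> {real (k i) + c <.. real (k i) + c + 1}" "y i \<in> {real (k' i) + c <.. real (k' i) + c + 1}"
        using i(1) by (auto simp: PiE_iff)
      then have "\<bar>real (k i) - real (k' i)\<bar> < 1" by auto
      with i(2) show False by linarith
    qed
  qed
  have cube: "emeasure (PiM I (\<lambda>_. lborel)) (?Q k) = 1" for k
    using lborel_PiM.emeasure_PiM[OF I, of "\<lambda>i. {real (k i) + c <.. real (k i) + c + 1}"] by simp
  have "emeasure (PiM I (\<lambda>_. lborel)) (\<Union>k\<in>K. ?Q k) = (\<Sum>k\<in>K. emeasure (PiM I (\<lambda>_. lborel)) (?Q k))"
    using sets K disj by (intro sum_emeasure[symmetric]) auto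
  also have "\<dots> = of_nat (card K)"
    by (simp only: cube) simp
  finally show "emeasure (PiM I (\<lambda>_. lborel)) (\<Union>k\<in>K. ?Q k) = of_nat (card K)" .
qed

text \<open>The unit cubes whose upper corners are the counted points lie inside the sublevel set, because
  the dimension polynomial is monotone.\<close>

lemma num_irreps_upto_le_volume:
  "of_nat (num_irreps_upto r x) \<le> emeasure (PiM {1..r} (\<lambda>_. lborel)) (dim_sublevel r x)"
proof -
  define K where "K = {k \<in> {1..r} \<rightarrow>\<^sub>E {1..}. dim_poly r (\<lambda>i. real (k i)) \<le> x}"
  have K: "finite K" "K \<subseteq> {1..r} \<rightarrow>\<^sub>E UNIV" "num_irreps_upto r x = card K"
    using num_irreps_upto_eq[of r x] by (auto simp: K_def)
  have "(\<Union>k\<in>K. \<Pi>\<^sub>E i\<in>{1..r}. {real (k i) + (-1) <.. real (k i) + (-1) + 1}) \<subseteq> dim_sublevel r x"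
  proof
    fix y assume "y \<in> (\<Union>k\<in>K. \<Pi>\<^sub>E i\<in>{1..r}. {real (k i) + (-1) <.. real (k i) + (-1) + 1})"
    then obtain k where k: "k \<in> K" and y: "y \<in> (\<Pi>\<^sub>E i\<in>{1..r}. {real (k i) + (-1) <.. real (k i) + (-1) + 1})"
      by blast
    have k1: "1 \<le> k i" if "i \<in> {1..r}" for i
      using k that by (auto simp: K_def PiE_iff)
    have yi: "0 < y i" "y i \<le> real (k i)" if "i \<in> {1..r}" for i
    proof -
      have "real (k i) - 1 < y i" "y i \<le> real (k i)" using y that by (auto simp: PiE_iff)
      then show "0 < y i" "y i \<le> real (k i)" using k1[OF that] by linarith+
    qed
    have "dim_poly r y \<le> dim_poly r (\<lambda>i. real (k i))"
      using yi by (intro dim_poly_mono) (auto simp: less_imp_le)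
    also have "\<dots> \<le> x" using k by (simp add: K_def)
    finally show "y \<in> dim_sublevel r x"
      using y yi by (auto simp: dim_sublevel_def PiE_iff)
  qed
  from emeasure_mono[OF this dim_sublevel_sets] show ?thesis
    unfolding K(3) by (subst (asm) emeasure_unit_cubes(2)) (use K in auto)
qed

text \<open>If all coordinates of a point of the sublevel set exceed 1, then rounding them up and subtracting
  1 gives positive integers strictly below the coordinates. By monotonicity these are a counted
  point, and the given point lies in the unit cube whose lower corner they form.\<close>

lemma volume_le_num_irreps_upto:
  "emeasure (PiM {1..r} (\<lambda>_. lborel)) (dim_sublevel r x) \<le> of_nat (num_irreps_upto r x) +
    (\<Sum>i=1..r. emeasure (PiM {1..r} (\<lambda>_. lborel)) {y \<in> dim_sublevel r x. y i \<le> 1})"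
proof -
  let ?M = "PiM {1..r} (\<lambda>_. lborel :: real measure)"
  define K where "K = {k \<in> {1..r} \<rightarrow>\<^sub>E {1..}. dim_poly r (\<lambda>i. real (k i)) \<le> x}"
  have K: "finite K" "K \<subseteq> {1..r} \<rightarrow>\<^sub>E UNIV" "num_irreps_upto r x = card K"
    using num_irreps_upto_eq[of r x] by (auto simp: K_def)
  let ?Q = "\<Union>k\<in>K. \<Pi>\<^sub>E i\<in>{1..r}. {real (k i) + 0 <.. real (k i) + 0 + 1}"
  let ?S = "\<lambda>i. {y \<in> dim_sublevel r x. y i \<le> 1}"
  have S_sets: "?S i \<in> sets ?M" if "i \<in> {1..r}" for i
    using that by (intro slab_sets dim_sublevel_sets)
  have cover: "dim_sublevel r x \<subseteq> ?Q \<union> (\<Union>i\<in>{1..r}. ?S i)"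
  proof
    fix y assume y: "y \<in> dim_sublevel r x"
    show "y \<in> ?Q \<union> (\<Union>i\<in>{1..r}. ?S i)"
    proof (cases "\<exists>i\<in>{1..r}. y i \<le> 1")
      case False
      define k where "k = (\<lambda>i\<in>{1..r}. nat (\<lceil>y i\<rceil> - 1))"
      have ki: "1 \<le> k i" "real (k i) < y i" "y i \<le> real (k i) + 1" if "i \<in> {1..r}" for i
      proof -
        have "\<not> y i \<le> 1" using False that by blast
        then have "2 \<le> \<lceil>y i\<rceil>" by linarith
        moreover have "k i = nat (\<lceil>y i\<rceil> - 1)" using that by (simp add: k_def)
        ultimately have "real (k i) = of_int \<lceil>y i\<rceil> - 1" "1 \<le> k i" by linarith+
        then show "1 \<le> k i" "real (k i) < y i" "y i \<le> real (k i) + 1" by linarith+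
      qed
      have "dim_poly r (\<lambda>i. real (k i)) \<le> dim_poly r y"
        using ki by (intro dim_poly_mono) (auto simp: less_imp_le)
      also have "\<dots> \<le> x" using y by (simp add: dim_sublevel_def)
      finally have "k \<in> K" using ki by (auto simp: K_def k_def)
      moreover have "y \<in> (\<Pi>\<^sub>E i\<in>{1..r}. {real (k i) + 0 <.. real (k i) + 0 + 1})"
        using y ki by (auto simp: dim_sublevel_def PiE_iff)
      ultimately show ?thesis by blast
    qed (use y in auto)
  qed
  have Q: "?Q \<in> sets ?M" "emeasure ?M ?Q = of_nat (card K)"
    using emeasure_unit_cubes[of "{1..r}" K 0] K by auto
  have "emeasure ?M (dim_sublevel r x) \<le> emeasure ?M (?Q \<union> (\<Union>i\<in>{1..r}. ?S i))"
    using cover S_sets by (intro emeasure_mono sets.Un[OF Q(1)] sets.finite_UN) auto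
  also have "\<dots> \<le> emeasure ?M ?Q + emeasure ?M (\<Union>i\<in>{1..r}. ?S i)"
    using S_sets by (intro emeasure_subadditive Q(1) sets.finite_UN) auto
  also have "\<dots> \<le> emeasure ?M ?Q + (\<Sum>i=1..r. emeasure ?M (?S i))"
    using S_sets by (intro add_left_mono emeasure_subadditive_finite) auto
  finally show ?thesis unfolding Q(2) K(3) .
qed

section \<open>The asymptotic formula\<close>

theorem proposition1p1:
  fixes r :: nat
  assumes "r \<ge> 1"
  shows "set_integrable (\<Pi>\<^sub>M j\<in>{1..r}. lborel) (dim_region r) (\<lambda>_. 1 :: real) \<and>
    (\<exists>K. \<forall>x::real. x > 0 \<longrightarrow>
      \<bar>real (num_irreps_upto r x) - leading_const r * x powr (2 / (real r + 1))\<bar>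
        \<le> K * x powr (2 * (real r - 1) / (real r)^2))"
proof
  let ?M = "\<Pi>\<^sub>M j\<in>{1..r}. lborel :: real measure"
  have region: "dim_region r = dim_sublevel r 1"
    by (simp add: dim_region_def dim_sublevel_def)
  have region_sets: "dim_region r \<in> sets ?M"
    unfolding region by (rule dim_sublevel_sets)
  have region_finite: "emeasure ?M (dim_region r) < \<infinity>"
    unfolding region by (rule emeasure_dim_sublevel_finite) simp
  show "set_integrable ?M (dim_region r) (\<lambda>_. 1 :: real)"
    using region_sets region_finite by (simp add: set_integrable_def)
  have leading: "leading_const r = measure ?M (dim_region r)"
    using region_sets region_finite sets.sets_into_space[OF region_sets]
    by (simp add: leading_const_def set_lebesgue_integral_def Int_absorb2)
  let ?N = "\<lambda>x. real (num_irreps_upto r x)"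
  let ?V = "\<lambda>x. measure ?M (dim_sublevel r x)"
  let ?b = "2 * (real r - 1) / (real r)^2"
  obtain C where C: "\<And>x i. 0 < x \<Longrightarrow> i \<in> {1..r} \<Longrightarrow>
      emeasure ?M {y \<in> dim_sublevel r x. y i \<le> 1} \<le> ennreal (C * x powr volume_exponent (r - 1) 2)"
    using emeasure_dim_sublevel_slab_le[OF assms] by blast
  \<comment> \<open>For \<open>r \<ge> 2\<close> this says \<open>2 / (r + 2) \<le> 2 * (r - 1) / r^2\<close>, with equality
    exactly for \<open>r = 2\<close>; for \<open>r = 1\<close> both sides are 0.\<close>
  have error_exponent: "volume_exponent (r - 1) 2 \<le> ?b"
  proof (cases "r = 1")
    case False
    then obtain n where n: "r = n + 2"
      using assms by (metis add.commute le_Suc_ex nat_less_le numeral_2_eq_2 Suc_leI One_nat_def)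
    have "volume_exponent (r - 1) 2 = 2 / (real n + 4)"
      using volume_exponent_Suc[of n 2] n by (simp add: add.commute)
    also have "\<dots> \<le> 2 * (real n + 1) / (real n + 2)^2"
      by (simp add: divide_simps power2_eq_square) (simp add: algebra_simps)
    finally show ?thesis using n by (simp add: add.commute)
  qed (simp add: volume_exponent_def)
  have main_exponent: "?b \<le> 2 / (real r + 1)"
    using assms by (simp add: divide_simps power2_eq_square) (simp add: algebra_simps)
  \<comment> \<open>For \<open>x \<ge> 1\<close> the error comes from the boundary layers, for \<open>x < 1\<close> from
    the main term, as nothing is counted there.\<close>
  have large: "\<bar>?N x - ?V x\<bar> \<le> real r * \<bar>C\<bar> * x powr ?b" if x: "1 \<le> x" for x
  proof -
    have V: "emeasure ?M (dim_sublevel r x) = ennreal (?V x)"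
      using emeasure_dim_sublevel_finite[of x r] x by (intro emeasure_eq_ennreal_measure) auto
    have lower: "?N x \<le> ?V x"
      using num_irreps_upto_le_volume[of r x] x V by (simp add: ennreal_of_nat_eq_real_of_nat)
    have "(\<Sum>i=1..r. emeasure ?M {y \<in> dim_sublevel r x. y i \<le> 1}) \<le> (\<Sum>i=1..r. ennreal (\<bar>C\<bar> * x powr ?b))"
    proof (rule sum_mono)
      fix i assume i: "i \<in> {1..r}"
      have "C * x powr volume_exponent (r - 1) 2 \<le> \<bar>C\<bar> * x powr ?b"
        using x error_exponent by (intro mult_mono powr_mono) auto
      then show "emeasure ?M {y \<in> dim_sublevel r x. y i \<le> 1} \<le> ennreal (\<bar>C\<bar> * x powr ?b)"
        using order_trans[OF C ennreal_leI] x i by simp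
    qed
    also have "\<dots> = ennreal (real r * \<bar>C\<bar> * x powr ?b)"
      by (simp add: ennreal_of_nat_eq_real_of_nat ennreal_mult' mult.assoc)
    finally have "ennreal (?V x) \<le> ennreal (?N x) + ennreal (real r * \<bar>C\<bar> * x powr ?b)"
      using volume_le_num_irreps_upto[of r x] x V
      by (simp add: ennreal_of_nat_eq_real_of_nat) (meson add_left_mono order_trans)
    also have "\<dots> = ennreal (?N x + real r * \<bar>C\<bar> * x powr ?b)"
      by (simp add: ennreal_plus)
    finally have "?V x \<le> ?N x + real r * \<bar>C\<bar> * x powr ?b"
      by (subst (asm) ennreal_le_iff) auto
    with lower show ?thesis by simp
  qed
  have small: "\<bar>?N x - ?V x\<bar> \<le> leading_const r * x powr ?b" if x: "0 < x" "x < 1" for x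
  proof -
    have no_dimensions: "{m. 1 \<le> m \<and> real m \<le> x} = {}" using x by auto
    have "?N x = 0" unfolding num_irreps_upto_def no_dimensions by simp
    moreover have "x powr (2 / (real r + 1)) \<le> x powr ?b"
      using x main_exponent by (intro powr_mono') auto
    ultimately show ?thesis
      using measure_dim_sublevel[OF x(1) assms] leading by (simp add: mult.commute mult_left_mono)
  qed
  have "\<bar>?N x - leading_const r * x powr (2 / (real r + 1))\<bar>
      \<le> (real r * \<bar>C\<bar> + leading_const r) * x powr ?b" if x: "0 < x" for x
  proof -
    have "\<bar>?N x - ?V x\<bar> \<le> (real r * \<bar>C\<bar> + leading_const r) * x powr ?b"
    proof (cases "1 \<le> x")
      case True
      then show ?thesis
        using large[OF True] leading by (simp add: distrib_right add_increasing2)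
    next
      case False
      then show ?thesis
        using small[OF x] by (simp add: distrib_right add_increasing)
    qed
    then show ?thesis
      using measure_dim_sublevel[OF x assms] leading by (simp add: mult.commute)
  qed
  then show "\<exists>K. \<forall>x::real. x > 0 \<longrightarrow>
      \<bar>?N x - leading_const r * x powr (2 / (real r + 1))\<bar> \<le> K * x powr ?b"
    by blast
qed

end
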